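(* The following formulae hold for $p$-adic valuations of the numbers $\frac{D_n^{(e)}}{n-1}$ and $\frac{D_n^{(o)}}{n-1}$, $n\ge2$: (1) $v_2\left(\frac{D_n^{(e)}}{n-1}\right)=v_2(n-2)-1$ for even $n\ge2$. (2) $v_2\left(\frac{D_n^{(o)}}{n-1}\right)=v_2(n-3)-1$ for odd $n\ge2$. (3) If $p$ is an odd prime number and $p\nmid q_p(2)$, then $v_p\left(\frac{D_n^{(e)}}{n-1}\right)=v_p(n-2)$ for all $n\ge2$ with $n\equiv2\pmod p$. (4) If $p$ is an odd prime number and $p\nmid q_p(3)$, then $v_p\left(\frac{D_n^{(o)}}{n-1}\right)=v_p(n-3)$ for all $n\ge2$ with $n\equiv3\pmod p$.
   Context: $D_n^{(e)}$ (respectively $D_n^{(o)}$) is the number of even (respectively odd) permutations of an $n$-element set without fixed points. They satisfy $D_0^{(e)}=1$, $D_1^{(e)}=0$, $D_0^{(o)}=0$, $D_1^{(o)}=0$, and $D_n^{(e)}=(n-1)(D_{n-2}^{(o)}+D_{n-1}^{(o)})$, $D_n^{(o)}=(n-1)(D_{n-2}^{(e)}+D_{n-1}^{(e)})$ for $n\ge2$. $v_p$ is the $p$-adic valuation with $v_p(0)=+\infty$ (and $+\infty-1=+\infty$). For a prime $p$ and integer $n\ge2$, $$q_p(n)=\frac{2}{p}\left(\frac{(-1)^{n+p}D_{n+p}^{(e)}}{n+p-1}-\frac{(-1)^{n}D_{n}^{(e)}}{n-1}\right)=\frac{2}{p}\left(\frac{(-1)^{n+p}D_{n+p}^{(o)}}{n+p-1}-\frac{(-1)^{n}D_{n}^{(o)}}{n-1}\right),$$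 which is an integer. *)

theory Defs
  imports
    "HOL-Combinatorics.Permutations"
    "HOL-Computational_Algebra.Primes"
    "HOL-Library.Extended_Real"
begin

definition derangements :: "nat \<Rightarrow> (nat \<Rightarrow> nat) set" where
  "derangements n = {\<pi>. \<pi> permutes {..<n} \<and> (\<forall>i<n. \<pi> i \<noteq> i)}"

definition even_derangements :: "nat \<Rightarrow> nat" where
  "even_derangements n = card {\<pi> \<in> derangements n. evenperm \<pi>}"

definition odd_derangements :: "nat \<Rightarrow> nat" where
  "odd_derangements n = card {\<pi> \<in> derangements n. \<not> evenperm \<pi>}"

(* Extended-real values give padic_val p 0 = \<infinity> and \<infinity> - 1 = \<infinity>, with no truncated
   subtraction on finite values. quotient_of returns the reduced fraction. *)
definition padic_val :: "nat \<Rightarrow> rat \<Rightarrow> ereal" where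
  "padic_val p x =
    (if x = 0 then \<infinity>
     else ereal (of_int (int (multiplicity (int p) (fst (quotient_of x)))
                       - int (multiplicity (int p) (snd (quotient_of x))))))"

(* The rational value of the defining expression of q_p(n). It is an integer for prime p and
   n \<ge> 2, and replacing even_derangements by odd_derangements gives the same number;
   neither fact is built into the definition. *)
definition q_quot :: "nat \<Rightarrow> nat \<Rightarrow> rat" where
  "q_quot p n =
    2 / of_nat p *
      ((- 1) ^ (n + p) * of_nat (even_derangements (n + p)) / (of_nat (n + p) - 1)
       - (- 1) ^ n * of_nat (even_derangements n) / (of_nat n - 1))"

(* Divisibility in the integers; dvd on type rat would be trivial. *)
definition int_divides :: "nat \<Rightarrow> rat \<Rightarrow> bool" where
  "int_divides p x \<longleftrightarrow> (\<exists>k::int. x = of_int (int p * k))"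

end

theory Submission
  imports Defs "HOL-Number_Theory.Cong"
begin

text \<open>
  Sorting the permutations of a set by their support shows that the numbers of derangements and
  the sums of their signs are the binomial inverses of \<open>n!\<close> and of \<open>[n \<le> 1]\<close>. Hence, with
  \<open>d n = (-1)^n D\<^sub>n\<close>, which satisfies \<open>d (n + 1) = 1 - (n + 1) d n\<close>,
  \<open>2 (-1)^n E\<^sub>n / (n - 1) = n d (n - 2) - 2 = (n - 2) (1 - n d (n - 3))\<close> and
  \<open>2 (-1)^n O\<^sub>n / (n - 1) = n d (n - 2) = (n - 3) n ((n - 2) d (n - 4) - 1)\<close>, where \<open>E\<^sub>n\<close> and
  \<open>O\<^sub>n\<close> count the even and the odd derangements.
  The recurrence makes \<open>d\<close> periodic modulo every \<open>p\<close>, so modulo \<open>p\<close> the cofactors of \<open>n - 2\<close> and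
  \<open>n - 3\<close> depend only on the residue of \<open>n\<close>; they are odd in the cases with \<open>p = 2\<close>, and their
  values at \<open>n = p + 2\<close> and \<open>n = p + 3\<close> are \<open>q\<^sub>p(2)\<close> and \<open>q\<^sub>p(3)\<close>.
\<close>

section \<open>Derangements and binomial inversion\<close>

text \<open>Supports of permutations need not be initial segments, so sorting by support calls for
  derangements of arbitrary sets.\<close>

definition derangements_on :: "'a set \<Rightarrow> ('a \<Rightarrow> 'a) set" where
  "derangements_on S = {\<pi>. \<pi> permutes S \<and> (\<forall>i\<in>S. \<pi> i \<noteq> i)}"

lemma finite_derangements_on: "finite S \<Longrightarrow> finite (derangements_on S)"
  unfolding derangements_on_def by (rule finite_subset[OF _ finite_permutations]) auto

lemma permutations_eq_Union_derangements_on: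
  "{\<pi>. \<pi> permutes S} = (\<Union>T\<in>Pow S. derangements_on T)"
proof (intro set_eqI iffI)
  fix \<pi> assume "\<pi> \<in> {\<pi>. \<pi> permutes S}"
  then have "\<pi> permutes {i\<in>S. \<pi> i \<noteq> i}"
    by (auto intro: permutes_superset)
  then have "\<pi> \<in> derangements_on {i\<in>S. \<pi> i \<noteq> i}"
    by (simp add: derangements_on_def)
  then show "\<pi> \<in> (\<Union>T\<in>Pow S. derangements_on T)"
    by (rule UN_I[rotated]) simp
next
  fix \<pi> assume "\<pi> \<in> (\<Union>T\<in>Pow S. derangements_on T)"
  then obtain T where "T \<subseteq> S" "\<pi> permutes T"
    unfolding derangements_on_def by blast
  then show "\<pi> \<in> {\<pi>. \<pi> permutes S}"
    by (simp add: permutes_subset)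
qed

text \<open>A derangement of a set determines that set as its support.\<close>

lemma derangements_on_disjoint:
  assumes "S \<noteq> T"
  shows "derangements_on S \<inter> derangements_on T = {}"
proof -
  have "S = {i. \<pi> i \<noteq> i}" if "\<pi> \<in> derangements_on S" for \<pi> and S :: "'a set"
    using that by (auto simp: derangements_on_def permutes_def)
  with assms show ?thesis by blast
qed

lemma sum_permutations_eq_sum_derangements_on:
  assumes "finite S"
  shows "(\<Sum>\<pi> | \<pi> permutes S. w \<pi>) = (\<Sum>T\<in>Pow S. \<Sum>\<pi>\<in>derangements_on T. w \<pi>)"
  unfolding permutations_eq_Union_derangements_on
proof (rule sum.UNION_disjoint)
  show "finite (Pow S)" using assms by simp
  show "\<forall>T\<in>Pow S. finite (derangements_on T)"
    using assms by (meson PowD finite_derangements_on finite_subset)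
  show "\<forall>T\<in>Pow S. \<forall>U\<in>Pow S. T \<noteq> U \<longrightarrow> derangements_on T \<inter> derangements_on U = {}"
    by (simp add: derangements_on_disjoint)
qed

lemma sum_Pow_card:
  fixes g :: "nat \<Rightarrow> int"
  assumes "finite S"
  shows "(\<Sum>T\<in>Pow S. g (card T)) = (\<Sum>k\<le>card S. int (card S choose k) * g k)"
proof -
  have "(\<Sum>T\<in>Pow S. g (card T)) = (\<Sum>k\<le>card S. \<Sum>T\<in>{T\<in>Pow S. card T = k}. g (card T))"
    using assms by (intro sum.group[symmetric]) (auto intro: card_mono)
  also have "\<dots> = (\<Sum>k\<le>card S. int (card S choose k) * g k)"
    using assms by (intro sum.cong) (auto simp: n_subsets)
  finally show ?thesis .
qed

text \<open>Binomial inversion by induction on proper subsets: summed over all subsets of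
  \<open>S\<close>, both sides give \<open>f (card S)\<close>, and the terms of proper subsets
  agree, so those of \<open>S\<close> do too. The weights used later are 1 and
  \<open>sign\<close>.\<close>

lemma sum_derangements_on:
  fixes w :: "('a \<Rightarrow> 'a) \<Rightarrow> int"
  assumes perms: "\<And>S. finite S \<Longrightarrow> (\<Sum>\<pi> | \<pi> permutes S. w \<pi>) = f (card S)"
    and binom: "\<And>n. (\<Sum>k\<le>n. int (n choose k) * g k) = f n"
    and "finite S"
  shows "(\<Sum>\<pi>\<in>derangements_on S. w \<pi>) = g (card S)"
  using \<open>finite S\<close>
proof (induction S rule: finite_psubset_induct)
  case (psubset S)
  let ?h = "\<lambda>T. \<Sum>\<pi>\<in>derangements_on T. w \<pi>"
  have "(\<Sum>T\<in>Pow S. ?h T) = (\<Sum>T\<in>Pow S. g (card T))"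
    using psubset.hyps
    by (simp add: sum_Pow_card binom perms flip: sum_permutations_eq_sum_derangements_on)
  moreover have "(\<Sum>T\<in>Pow S - {S}. ?h T) = (\<Sum>T\<in>Pow S - {S}. g (card T))"
    using psubset.IH by (intro sum.cong) auto
  ultimately show ?case
    using psubset.hyps by (simp add: sum.remove[of "Pow S" S])
qed

text \<open>As soon as \<open>S\<close> has two elements, composing with their transposition
  permutes the summands and flips every sign, so the sum equals its own negative.\<close>

lemma sum_sign_permutations:
  assumes "finite (S :: 'a set)"
  shows "(\<Sum>\<pi> | \<pi> permutes S. sign \<pi>) = (if card S \<le> 1 then 1 else 0)"
proof (cases "card S \<le> 1")
  case True
  then have "{\<pi>. \<pi> permutes S} = {id}"
    using assms by (auto simp: le_Suc_eq card_1_singleton_iff permutes_empty permutes_sing)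
  then show ?thesis using True by (simp add: sign_id)
next
  case False
  then obtain a b where ab: "a \<in> S" "b \<in> S" "a \<noteq> b"
    using card_le_Suc0_iff_eq[OF assms] by auto
  have "(\<Sum>\<pi> | \<pi> permutes S. sign \<pi>) = (\<Sum>\<pi> | \<pi> permutes S. sign (transpose a b \<circ> \<pi>))"
    using ab by (intro setum_permutations_compose_left permutes_swap_id)
  also have "\<dots> = (\<Sum>\<pi> | \<pi> permutes S. - sign \<pi>)"
    using ab assms
    by (intro sum.cong)
      (auto simp: sign_compose permutes_imp_permutation permutation_swap_id sign_swap_id)
  finally show ?thesis using False by (simp add: sum_negf)
qed

section \<open>Signed derangement numbers\<close>

text \<open>The sign (-1)^n turns the alternating term of D_n = n D_{n-1} + (-1)^n into the constant
  1, which makes the sequence periodic modulo every p.\<close>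

fun signed_der :: "nat \<Rightarrow> int" where
  "signed_der 0 = 1"
| "signed_der (Suc n) = 1 - int (Suc n) * signed_der n"

lemma sum_choose_alternating: "(\<Sum>k\<le>n. int (n choose k) * (-1) ^ k) = (if n = 0 then 1 else 0)"
  using choose_alternating_sum[of n, where 'a = int] by (auto simp: mult.commute)

text \<open>The recurrence splits each term in two. The alternating sum vanishes for
  \<open>Suc n\<close>, and absorption, (k+1) C(n+1,k+1) = (n+1) C(n,k), reduces the rest to n + 1
  times the sum for n.\<close>

lemma sum_choose_derangement_numbers:
  "(\<Sum>k\<le>n. int (n choose k) * ((-1) ^ k * signed_der k)) = fact n"
proof (induction n)
  case (Suc n)
  have *: "int (Suc n choose Suc k) * ((-1) ^ Suc k * signed_der (Suc k)) =
      int (Suc n choose Suc k) * (-1) ^ Suc k +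
      int (Suc n) * (int (n choose k) * ((-1) ^ k * signed_der k))" for k
  proof -
    have "int (Suc k) * int (Suc n choose Suc k) = int (Suc n) * int (n choose k)"
      by (metis Suc_times_binomial_eq of_nat_mult mult.commute)
    then show ?thesis by (simp del: binomial_Suc_Suc of_nat_Suc add: algebra_simps)
  qed
  have "(\<Sum>k\<le>Suc n. int (Suc n choose k) * ((-1) ^ k * signed_der k)) =
      (\<Sum>k\<le>Suc n. int (Suc n choose k) * (-1) ^ k) +
      int (Suc n) * (\<Sum>k\<le>n. int (n choose k) * ((-1) ^ k * signed_der k))"
    unfolding sum.atMost_Suc_shift[of _ n] * sum.distrib sum_distrib_left by simp
  then show ?case
    by (simp add: Suc.IH sum_choose_alternating del: sum.atMost_Suc binomial_Suc_Suc)
qed simp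

text \<open>For positive n, absorption turns the part weighted by k into an alternating sum for n -
  1, which survives only at n = 1.\<close>

lemma sum_choose_signed_count:
  "(\<Sum>k\<le>n. int (n choose k) * ((-1) ^ k * (1 - int k))) = (if n \<le> 1 then 1 else 0)"
proof (cases n)
  case (Suc m)
  have *: "int (Suc m choose Suc k) * ((-1) ^ Suc k * int (Suc k)) =
      - int (Suc m) * (int (m choose k) * (-1) ^ k)" for k
  proof -
    have "int (Suc k) * int (Suc m choose Suc k) = int (Suc m) * int (m choose k)"
      by (metis Suc_times_binomial_eq of_nat_mult mult.commute)
    then show ?thesis by (simp del: binomial_Suc_Suc of_nat_Suc add: algebra_simps)
  qed
  have "(\<Sum>k\<le>n. int (n choose k) * ((-1) ^ k * int k)) = (if m = 0 then -1 else 0)"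
    unfolding Suc sum.atMost_Suc_shift[of _ m] * sum_distrib_left[symmetric]
    by (simp add: sum_choose_alternating)
  then show ?thesis
    using sum_choose_alternating[of n] Suc
    by (simp add: right_diff_distrib sum_subtractf del: sum.atMost_Suc binomial_Suc_Suc)
qed simp

lemma even_odd_derangements:
  shows "int (even_derangements n) + int (odd_derangements n) = (-1) ^ n * signed_der n"
    and "int (even_derangements n) - int (odd_derangements n) = (-1) ^ n * (1 - int n)"
proof -
  let ?D = "derangements_on {..<n}"
  have fin: "finite ?D" by (simp add: finite_derangements_on)
  have e: "even_derangements n = card (?D \<inter> {\<pi>. evenperm \<pi>})"
    unfolding even_derangements_def derangements_def derangements_on_def
    by (rule arg_cong[where f = card]) auto
  have o: "odd_derangements n = card (?D \<inter> - {\<pi>. evenperm \<pi>})"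
    unfolding odd_derangements_def derangements_def derangements_on_def
    by (rule arg_cong[where f = card]) auto
  have "(\<Sum>\<pi>\<in>?D. 1) = (-1) ^ card {..<n} * signed_der (card {..<n})"
    by (rule sum_derangements_on[where f = fact])
      (auto simp: sum_choose_derangement_numbers card_permutations)
  then show "int (even_derangements n) + int (odd_derangements n) = (-1) ^ n * signed_der n"
    unfolding e o using sum.Int_Diff[OF fin, of "\<lambda>_. 1::int" "{\<pi>. evenperm \<pi>}"]
    by (simp add: Diff_eq)
  have "(\<Sum>\<pi>\<in>?D. sign \<pi>) = (-1) ^ card {..<n} * (1 - int (card {..<n}))"
    by (rule sum_derangements_on[where f = "\<lambda>n. if n \<le> 1 then 1 else 0"])
      (simp_all add: sum_sign_permutations sum_choose_signed_count)
  moreover have "(\<Sum>\<pi>\<in>?D. sign \<pi>) = int (even_derangements n) - int (odd_derangements n)"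
    unfolding e o sign_def using fin by (simp add: sum.If_cases)
  ultimately show "int (even_derangements n) - int (odd_derangements n) = (-1) ^ n * (1 - int n)"
    by simp
qed

text \<open>With n = m + 2, unfolding the recurrence twice exposes the denominator n - 1 = m + 1 as
  a factor of both the sum and the difference of the two counts.\<close>

lemma even_derangements_signed_der:
  "2 * int (even_derangements (m + 2)) =
    (-1) ^ m * ((int m + 1) * ((int m + 2) * signed_der m - 2))"
  using even_odd_derangements[of "m + 2"]
  by (simp add: numeral_2_eq_2 algebra_simps)

lemma odd_derangements_signed_der:
  "2 * int (odd_derangements (m + 2)) = (-1) ^ m * ((int m + 1) * ((int m + 2) * signed_der m))"
  using even_odd_derangements[of "m + 2"]
  by (simp add: numeral_2_eq_2 algebra_simps)

text \<open>A shift of the index by p changes the coefficient in the recurrence by p, so the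
  congruence passes from n to n + 1.\<close>

lemma signed_der_cong:
  assumes "m mod p = n mod p"
  shows "int p dvd signed_der m - signed_der n"
proof -
  have *: "int p dvd signed_der (n + p) - signed_der n" for n
  proof (induction n)
    case 0
    \<comment> \<open>For positive p, \<open>signed_der p\<close> is 1 minus a multiple of p, and
      \<open>signed_der 0\<close> is 1.\<close>
    show ?case by (cases p) auto
  next
    case (Suc n)
    have "signed_der (Suc n + p) - signed_der (Suc n) =
        - int (Suc n) * (signed_der (n + p) - signed_der n) - int p * signed_der (n + p)"
      by (simp add: algebra_simps)
    then show ?case using Suc by (metis dvd_diff dvd_mult dvd_triv_left)
  qed
  have "int p dvd signed_der (n + j * p) - signed_der n" for n j
  proof (induction j)
    case (Suc j)
    have "int p dvd (signed_der (n + j * p + p) - signed_der (n + j * p)) +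
        (signed_der (n + j * p) - signed_der n)"
      using * Suc by (rule dvd_add)
    then show ?case by (simp add: ac_simps)
  qed simp
  from this[of "m mod p" "m div p"] this[of "n mod p" "n div p"] assms
  have "int p dvd signed_der m - signed_der (m mod p) - (signed_der n - signed_der (m mod p))"
    by (metis dvd_diff mod_div_mult_eq)
  then show ?thesis by simp
qed

lemma even_signed_der_iff: "even (signed_der n) \<longleftrightarrow> odd n"
  by (induction n) auto

lemma signed_der_factor_even:
  "(int (Suc m) + 2) * signed_der (Suc m) - 2 =
    int (Suc m) * (1 - (int (Suc m) + 2) * signed_der m)"
  by (simp add: algebra_simps)

lemma signed_der_factor_odd:
  "signed_der (m + 2) = (int m + 1) * ((int m + 2) * signed_der m - 1)"
  by (simp add: numeral_2_eq_2 algebra_simps)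

section \<open>Valuations\<close>

lemma padic_val_of_int:
  "padic_val p (of_int z) = (if z = 0 then \<infinity> else ereal (real (multiplicity (int p) z)))"
  by (simp add: padic_val_def)

text \<open>Common core of all four formulas: \<open>t\<close> will be n - 2 or n - 3, the cofactor
  \<open>s\<close> is prime to p and contributes nothing, and halving costs 1 exactly when p =
  2.\<close>

lemma padic_val_half_product:
  fixes E m :: nat and t s :: int
  assumes eq: "2 * int E = (-1) ^ m * ((int m + 1) * (t * s))"
    and ev: "even (t * s)" and p: "prime p" and s: "\<not> int p dvd s"
  shows "padic_val p (of_nat E / (of_nat (m + 2) - 1)) =
    padic_val p (of_int t) - (if p = 2 then 1 else 0)"
proof -
  from ev obtain x where x: "t * s = 2 * x" by blast
  \<comment> \<open>This integer is the quotient E / (m + 1) whose valuation is sought.\<close>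
  define y where "y = (-1) ^ m * x"
  have "int E = (int m + 1) * y"
    using eq unfolding x y_def by simp
  then have "(of_nat E :: rat) = (of_nat m + 1) * of_int y"
    by (metis of_int_1 of_int_add of_int_mult of_int_of_nat_eq)
  then have E: "of_nat E / (of_nat (m + 2) - 1) = (of_int y :: rat)"
    by (simp add: field_simps)
  have y2: "t * s = (-1) ^ m * (2 * y)"
    by (simp add: y_def x flip: mult.assoc power_add)
  have "s \<noteq> 0" using s by auto
  have pp: "prime_elem (int p)" using p by simp
  show ?thesis
  proof (cases "t = 0")
    \<comment> \<open>Both valuations are infinite, and subtracting 0 or 1 leaves infinity.\<close>
    case True
    then have "y = 0" using y2 by simp
    then show ?thesis using True E by (simp add: padic_val_def)
  next
    case False
    then have "y \<noteq> 0" using y2 \<open>s \<noteq> 0\<close> by auto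
    have "multiplicity (int p) t = multiplicity (int p) (t * s)"
      using pp False \<open>s \<noteq> 0\<close> s
      by (simp add: prime_elem_multiplicity_mult_distrib not_dvd_imp_multiplicity_0)
    also have "\<dots> = multiplicity (int p) (2 * y)"
      unfolding y2 by (intro multiplicity_times_unit_right) simp
    also have "\<dots> = multiplicity (int p) 2 + multiplicity (int p) y"
      using pp \<open>y \<noteq> 0\<close> by (simp add: prime_elem_multiplicity_mult_distrib)
    also have "multiplicity (int p) 2 = (if p = 2 then 1 else 0)"
    proof (cases "p = 2")
      case False
      then have "\<not> p dvd 2" using p primes_dvd_imp_eq two_is_prime_nat by blast
      then have "\<not> int p dvd 2" by (metis of_nat_dvd_iff of_nat_numeral)
      then show ?thesis using False by (simp add: not_dvd_imp_multiplicity_0)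
    qed (simp add: multiplicity_self)
    finally show ?thesis
      using \<open>y \<noteq> 0\<close> False E by (simp add: padic_val_of_int one_ereal_def del: of_nat_add)
  qed
qed

lemma padic_val_even_derangements:
  assumes p: "prime p"
    and s: "\<And>k. m = Suc k \<Longrightarrow> \<not> int p dvd 1 - (int m + 2) * signed_der k"
  shows "padic_val p (of_nat (even_derangements (m + 2)) / (of_nat (m + 2) - 1)) =
    padic_val p (of_nat (m + 2) - 2) - (if p = 2 then 1 else 0)"
proof -
  obtain c where c: "(int m + 2) * signed_der m - 2 = int m * c" "\<not> int p dvd c"
  proof (cases m)
    \<comment> \<open>Here n = 2 and both sides vanish, so any cofactor prime to p will do.\<close>
    case 0
    then show ?thesis using that[of 1] prime_gt_1_nat[OF p] by auto
  next
    case (Suc k)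
    then show ?thesis using that s signed_der_factor_even[of k] by blast
  qed
  \<comment> \<open>For even m the factor m + 2 is even, for odd m the factor
    \<open>signed_der m\<close> is.\<close>
  have "even ((int m + 2) * signed_der m - 2)"
    by (auto simp: even_signed_der_iff)
  then show ?thesis
    using padic_val_half_product[of "even_derangements (m + 2)" m "int m" c p]
      even_derangements_signed_der[of m] c p by simp
qed

lemma padic_val_odd_derangements:
  assumes p: "prime p"
    and s: "\<And>k. m = k + 2 \<Longrightarrow> \<not> int p dvd (int m + 2) * (int m * signed_der k - 1)"
    and "m \<noteq> 0"
  shows "padic_val p (of_nat (odd_derangements (m + 2)) / (of_nat (m + 2) - 1)) =
    padic_val p (of_nat (m + 2) - 3) - (if p = 2 then 1 else 0)"
proof -
  obtain c where c: "(int m + 2) * signed_der m = (int m - 1) * c" "\<not> int p dvd c"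
  proof (cases "m = 1")
    \<comment> \<open>Here n = 3; both sides vanish because \<open>signed_der 1\<close> is
      0.\<close>
    case True
    then show ?thesis using that[of 1] prime_gt_1_nat[OF p] by auto
  next
    case False
    then obtain k where k: "m = k + 2"
      using \<open>m \<noteq> 0\<close> by (metis One_nat_def add.commute add_2_eq_Suc not0_implies_Suc)
    then have "(int m + 2) * signed_der m =
        (int m - 1) * ((int m + 2) * (int m * signed_der k - 1))"
      using signed_der_factor_odd[of k] by (simp add: algebra_simps)
    then show ?thesis using that s k by blast
  qed
  have "even ((int m + 2) * signed_der m)"
    by (auto simp: even_signed_der_iff)
  then show ?thesis
    using padic_val_half_product[of "odd_derangements (m + 2)" m "int m - 1" c p]
      odd_derangements_signed_der[of m] c p by simp
qed

section \<open>Closed forms of q_p(2) and q_p(3)\<close>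

lemma even_derangements_quotient:
  "(-1) ^ (m + 2) * of_nat (even_derangements (m + 2)) / (of_nat (m + 2) - 1) =
    (of_int ((int m + 2) * signed_der m - 2) / 2 :: rat)"
proof -
  have "2 * (of_nat (even_derangements (m + 2)) :: rat) =
      of_int (2 * int (even_derangements (m + 2)))" by simp
  also have "\<dots> = (-1) ^ m * ((of_nat m + 1) * of_int ((int m + 2) * signed_der m - 2))"
    unfolding even_derangements_signed_der by simp
  finally have *: "of_nat (even_derangements (m + 2)) =
      ((-1) ^ m * ((of_nat m + 1) * of_int ((int m + 2) * signed_der m - 2)) / 2 :: rat)"
    by simp
  have "of_nat m + 1 \<noteq> (0 :: rat)"
    by (metis of_nat_Suc of_nat_eq_0_iff nat.simps(3) add.commute)
  then show ?thesis
    unfolding * by (simp add: field_simps flip: power_add mult_2)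
qed

lemma q_quot_2:
  assumes "p = Suc k"
  shows "q_quot p 2 = of_int (1 - (int p + 2) * signed_der k)"
proof -
  have "even_derangements 2 = 0"
    using even_derangements_signed_der[of 0] by (simp add: numeral_2_eq_2)
  then have "q_quot p 2 = of_int ((int p + 2) * signed_der p - 2) / of_nat p"
    unfolding q_quot_def add.commute[of 2 p] even_derangements_quotient
    by (simp add: diff_divide_distrib right_diff_distrib)
  also have "(int p + 2) * signed_der p - 2 = int p * (1 - (int p + 2) * signed_der k)"
    unfolding assms by (rule signed_der_factor_even)
  finally show ?thesis using assms by (simp del: of_nat_Suc)
qed

text \<open>The subtracted term is -1, since three elements have two even derangements. It cancels
  the constant that distinguishes the even from the odd quotient, so q_p(3) is the cofactor of n - 3
  in the odd case at n = p + 3.\<close>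

lemma q_quot_3:
  assumes "p = Suc k"
  shows "q_quot p 3 = of_int ((int p + 3) * ((int p + 1) * signed_der k - 1))"
proof -
  have p3: "3 + p = (k + 2) + 2" using assms by simp
  have "even_derangements 3 = 2"
    using even_derangements_signed_der[of 1] by (simp add: numeral_3_eq_3)
  then have "q_quot p 3 =
      2 / of_nat p * (of_int ((int (k + 2) + 2) * signed_der (k + 2) - 2) / 2 + 1)"
    unfolding q_quot_def p3 even_derangements_quotient by simp
  also have "\<dots> = of_int ((int (k + 2) + 2) * signed_der (k + 2)) / of_nat p"
    by (simp add: add_divide_distrib diff_divide_distrib right_diff_distrib distrib_left
        del: of_nat_add)
  also have "int (k + 2) + 2 = int p + 3" using assms by simp
  also have "(int p + 3) * signed_der (k + 2) =
      int p * ((int p + 3) * ((int p + 1) * signed_der k - 1))"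
    unfolding signed_der_factor_odd assms by (simp add: algebra_simps)
  finally show ?thesis using assms by (simp del: of_nat_Suc)
qed

section \<open>Transfer along residue classes and the four formulas\<close>

lemma int_divides_of_int: "int_divides p (of_int z) \<longleftrightarrow> int p dvd z"
  unfolding int_divides_def dvd_def of_int_eq_iff ..

lemma int_dvd_of_mod_eq: "m mod p = n mod p \<Longrightarrow> int p dvd int m - int n"
  by (metis mod_eq_dvd_iff of_nat_mod)

lemma mod_eq_add_cancel: "(m + k) mod p = (n + k) mod p \<Longrightarrow> m mod p = n mod (p :: nat)"
  using cong_add_rcancel_nat[of m k n p] unfolding cong_def by simp

theorem corollary6:
  shows "(\<forall>n::nat. n \<ge> 2 \<and> even n \<longrightarrow>
            padic_val 2 (of_nat (even_derangements n) / (of_nat n - 1))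
              = padic_val 2 (of_nat n - 2) - 1)
       \<and> (\<forall>n::nat. n \<ge> 2 \<and> odd n \<longrightarrow>
            padic_val 2 (of_nat (odd_derangements n) / (of_nat n - 1))
              = padic_val 2 (of_nat n - 3) - 1)
       \<and> (\<forall>p::nat. prime p \<and> odd p \<and> \<not> int_divides p (q_quot p 2) \<longrightarrow>
            (\<forall>n::nat. n \<ge> 2 \<and> n mod p = 2 mod p \<longrightarrow>
              padic_val p (of_nat (even_derangements n) / (of_nat n - 1))
                = padic_val p (of_nat n - 2)))
       \<and> (\<forall>p::nat. prime p \<and> odd p \<and> \<not> int_divides p (q_quot p 3) \<longrightarrow>
            (\<forall>n::nat. n \<ge> 2 \<and> n mod p = 3 mod p \<longrightarrow>
              padic_val p (of_nat (odd_derangements n) / (of_nat n - 1))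
                = padic_val p (of_nat n - 3)))"
proof (intro conjI allI impI)
  fix n :: nat
  assume "2 \<le> n \<and> even n"
  then obtain m where n: "n = m + 2" "even m" using le_Suc_ex[of 2 n] by auto
  \<comment> \<open>The product is even because m + 2 is, so the cofactor is odd.\<close>
  then have "\<not> int 2 dvd 1 - (int m + 2) * signed_der k" if "m = Suc k" for k
    using that by (simp add: even_signed_der_iff)
  from padic_val_even_derangements[OF two_is_prime_nat this]
  show "padic_val 2 (of_nat (even_derangements n) / (of_nat n - 1)) =
      padic_val 2 (of_nat n - 2) - 1"
    using n by simp
next
  fix n :: nat
  assume "2 \<le> n \<and> odd n"
  then obtain m where n: "n = m + 2" "odd m" using le_Suc_ex[of 2 n] by auto
  \<comment> \<open>With m, also k is odd, so \<open>signed_der k\<close> is even and both factors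
    are odd.\<close>
  then have "\<not> int 2 dvd (int m + 2) * (int m * signed_der k - 1)" if "m = k + 2" for k
    using that by (simp add: even_signed_der_iff)
  from padic_val_odd_derangements[OF two_is_prime_nat this]
  show "padic_val 2 (of_nat (odd_derangements n) / (of_nat n - 1)) =
      padic_val 2 (of_nat n - 3) - 1"
    using n odd_pos[OF n(2)] by simp
next
  fix p n :: nat
  assume p: "prime p \<and> odd p \<and> \<not> int_divides p (q_quot p 2)"
    and n: "2 \<le> n \<and> n mod p = 2 mod p"
  obtain m where m: "n = m + 2" using n le_Suc_ex[of 2 n] by (auto simp: add.commute)
  obtain l where l: "p = Suc l" using p prime_gt_0_nat gr0_implies_Suc by blast
  have q: "\<not> int p dvd 1 - (int p + 2) * signed_der l"
    using p unfolding q_quot_2[OF l] int_divides_of_int by blast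
  have mp: "m mod p = p mod p" using n m mod_eq_add_cancel[of m 2 p 0] by (simp add: numeral_2_eq_2)
  have "\<not> int p dvd 1 - (int m + 2) * signed_der k" if k: "m = Suc k" for k
  proof
    assume a: "int p dvd 1 - (int m + 2) * signed_der k"
    \<comment> \<open>The predecessors of m and p are congruent, so the cofactor at m agrees modulo
      p with the one at p, which is q_p(2).\<close>
    have "k mod p = l mod p"
      using mp mod_eq_add_cancel[of k 1 p l] k l by simp
    then have kl: "[signed_der k = signed_der l] (mod int p)"
      unfolding cong_iff_dvd_diff by (rule signed_der_cong)
    have "[int m = int p] (mod int p)"
      unfolding cong_iff_dvd_diff using mp by (rule int_dvd_of_mod_eq)
    with kl have "[1 - (int m + 2) * signed_der k = 1 - (int p + 2) * signed_der l] (mod int p)"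
      by (intro cong_mult cong_add cong_diff cong_refl)
    then show False using a q by (simp add: cong_dvd_iff)
  qed
  then show "padic_val p (of_nat (even_derangements n) / (of_nat n - 1)) =
      padic_val p (of_nat n - 2)"
    using padic_val_even_derangements[of p m] p m by auto
next
  fix p n :: nat
  assume p: "prime p \<and> odd p \<and> \<not> int_divides p (q_quot p 3)"
    and n: "2 \<le> n \<and> n mod p = 3 mod p"
  obtain m where m: "n = m + 2" using n le_Suc_ex[of 2 n] by (auto simp: add.commute)
  obtain l where l: "p = Suc l" using p prime_gt_0_nat gr0_implies_Suc by blast
  have q: "\<not> int p dvd (int p + 3) * ((int p + 1) * signed_der l - 1)"
    using p unfolding q_quot_3[OF l] int_divides_of_int by blast
  have m1: "m mod p = 1 mod p" using n m mod_eq_add_cancel[of m 2 p 1] by (simp add: numeral_3_eq_3)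
  \<comment> \<open>The representative p + 1 is chosen because q_p(3) is the cofactor at m = p +
    1.\<close>
  then have mp: "m mod p = (p + 1) mod p" by (metis mod_add_self1)
  have "m \<noteq> 0" using m1 p prime_gt_1_nat[of p] by (cases "m = 0") auto
  moreover have "\<not> int p dvd (int m + 2) * (int m * signed_der k - 1)" if k: "m = k + 2" for k
  proof
    assume a: "int p dvd (int m + 2) * (int m * signed_der k - 1)"
    have "k mod p = l mod p"
      using mp mod_eq_add_cancel[of k 2 p l] k l by simp
    then have kl: "[signed_der k = signed_der l] (mod int p)"
      unfolding cong_iff_dvd_diff by (rule signed_der_cong)
    have "[int m = int p + 1] (mod int p)"
      using int_dvd_of_mod_eq[OF mp] by (simp add: cong_iff_dvd_diff add.commute)
    with kl have "[(int m + 2) * (int m * signed_der k - 1) =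
        (int p + 1 + 2) * ((int p + 1) * signed_der l - 1)] (mod int p)"
      by (intro cong_mult cong_add cong_diff cong_refl)
    then show False using a q by (simp add: cong_dvd_iff add.commute[of 3])
  qed
  ultimately show "padic_val p (of_nat (odd_derangements n) / (of_nat n - 1)) =
      padic_val p (of_nat n - 3)"
    using padic_val_odd_derangements[of p m] p m by auto
qed

end
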